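(* If $(X,h)$ is a topological dynamical system with $X$ infinite, then the following assertions are equivalent: (i) $C(X) \rtimes_{\tilde{h}} \mathbb{Z}$ is a simple algebra. (ii) $C(X)$ is maximal commutative in $C(X) \rtimes_{\tilde{h}} \mathbb{Z}$ and $C(X)$ is $\mathbb{Z}$-simple. (iii) $(X,h)$ is a minimal dynamical system.
   Context: A topological dynamical system $(X,h)$ consists of a compact Hausdorff space $X$ and a homeomorphism $h:X\to X$. $C(X)$ is the algebra of complex-valued continuous functions on $X$ with pointwise operations. For $n\in\mathbb{Z}$ let $h^{\circ(n)}$ be the $n$-th iterate of $h$ and define $\tilde{h}:\mathbb{Z}\to\mathrm{Aut}(C(X))$ by $\tilde{h}_n(f)=f\circ h^{\circ(n)}$. The (purely algebraic) crossed product, i.e. skew group algebra, $C(X)\rtimes_{\tilde{h}}\mathbb{Z}$ consists of formal sums $\sum_{n\in\mathbb{Z}}f_n\,u_n$ with $f_n\in C(X)$, all but finitely many zero, with multiplication the bilinear extension of $(f_n\,u_n)(g_m\,u_m)=f_n\,\tilde{h}_n(g_m)\,u_{n+m}$; $C(X)$ is identified with $C(X)u_0$. Ideals are arbitrary two-sided (algebraic, not necessarily closed) ideals. An algebra is simple if it has no ideals other than $\{0\}$ and itself. A commutative subalgebra is maximal commutative if it equals its commutant (the set of all elements commuting with each of its elements). $C(X)$ is $\mathbb{Z}$-simple if it has no ideal $I$ other than $\{0\}$ and $C(X)$ satisfying $\tilde{h}_n(I)\subseteq I$ for all $n\in\mathbb{Z}$. $(X,h)$ is minimal if each orbit $\{h^{\circ(n)}(x)\mid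 n\in\mathbb{Z}\}$, $x\in X$, is dense in $X$. *)

theory Defs
  imports
    "HOL-Analysis.Analysis"
    "HOL-Algebra.Ideal"
    "HOL-Algebra.Module"
    "HOL-Algebra.Subrings"
begin

definition topological_dynamical_system :: "'a topology \<Rightarrow> ('a \<Rightarrow> 'a) \<Rightarrow> bool" where
  "topological_dynamical_system X h \<longleftrightarrow>
     compact_space X \<and> Hausdorff_space X \<and> homeomorphic_map X X h"

text \<open>Negative iterates use the inverse of \<open>h\<close> as a bijection of \<open>topspace X\<close>; the values
  outside \<open>topspace X\<close> are irrelevant.\<close>

definition iterate :: "'a topology \<Rightarrow> ('a \<Rightarrow> 'a) \<Rightarrow> int \<Rightarrow> 'a \<Rightarrow> 'a" where
  "iterate X h n = (if 0 \<le> n then h ^^ nat n else inv_into (topspace X) h ^^ nat (- n))"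

definition orbit :: "'a topology \<Rightarrow> ('a \<Rightarrow> 'a) \<Rightarrow> 'a \<Rightarrow> 'a set" where
  "orbit X h x = {iterate X h n x | n. True}"

definition minimal_system :: "'a topology \<Rightarrow> ('a \<Rightarrow> 'a) \<Rightarrow> bool" where
  "minimal_system X h \<longleftrightarrow> (\<forall>x \<in> topspace X. X closure_of orbit X h x = topspace X)"

text \<open>A complex algebra is represented by a record of type \<open>(complex, 'b) module\<close>,
  i.e. a ring record together with a scalar multiplication by complex numbers.
  Closure under scalars is automatic for ring ideals of a unital algebra; it is included so
  that the notion is literally that of an ideal of an algebra.\<close>

definition algebra_ideal :: "'b set \<Rightarrow> (complex, 'b) module \<Rightarrow> bool" where
  "algebra_ideal I A \<longleftrightarrow> ideal I A \<and> (\<forall>c. \<forall>a \<in> I. c \<odot>\<^bsub>A\<^esub> a \<in> I)"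

definition simple_algebra :: "(complex, 'b) module \<Rightarrow> bool" where
  "simple_algebra A \<longleftrightarrow> (\<forall>I. algebra_ideal I A \<longrightarrow> I = {\<zero>\<^bsub>A\<^esub>} \<or> I = carrier A)"

definition invariant_simple ::
    "(complex, 'b) module \<Rightarrow> (int \<Rightarrow> 'b \<Rightarrow> 'b) \<Rightarrow> bool" where
  "invariant_simple A \<sigma> \<longleftrightarrow>
     (\<forall>I. algebra_ideal I A \<and> (\<forall>n. \<sigma> n ` I \<subseteq> I) \<longrightarrow> I = {\<zero>\<^bsub>A\<^esub>} \<or> I = carrier A)"

definition commutative_subalgebra :: "'b set \<Rightarrow> (complex, 'b) module \<Rightarrow> bool" where
  "commutative_subalgebra B A \<longleftrightarrow> subcring B A \<and> (\<forall>c. \<forall>b \<in> B. c \<odot>\<^bsub>A\<^esub> b \<in> B)"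

definition commutant :: "(complex, 'b) module \<Rightarrow> 'b set \<Rightarrow> 'b set" where
  "commutant A B = {a \<in> carrier A. \<forall>b \<in> B. a \<otimes>\<^bsub>A\<^esub> b = b \<otimes>\<^bsub>A\<^esub> a}"

definition maximal_commutative :: "'b set \<Rightarrow> (complex, 'b) module \<Rightarrow> bool" where
  "maximal_commutative B A \<longleftrightarrow> commutative_subalgebra B A \<and> B = commutant A B"

text \<open>Functions on \<open>X\<close> are extensional, so that equality in the carrier is equality on
  \<open>topspace X\<close>.\<close>

definition cont_algebra :: "'a topology \<Rightarrow> (complex, 'a \<Rightarrow> complex) module" where
  "cont_algebra X =
    \<lparr> carrier = {f \<in> extensional (topspace X). continuous_map X euclidean f},
      mult = (\<lambda>f g. \<lambda>x \<in> topspace X. f x * g x),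
      one = (\<lambda>x \<in> topspace X. 1),
      zero = (\<lambda>x \<in> topspace X. 0),
      add = (\<lambda>f g. \<lambda>x \<in> topspace X. f x + g x),
      smult = (\<lambda>c f. \<lambda>x \<in> topspace X. c * f x) \<rparr>"

definition induced_action ::
    "'a topology \<Rightarrow> ('a \<Rightarrow> 'a) \<Rightarrow> int \<Rightarrow> ('a \<Rightarrow> complex) \<Rightarrow> ('a \<Rightarrow> complex)" where
  "induced_action X h n f = compose (topspace X) f (iterate X h n)"

text \<open>The formal sum of the \<open>f\<^sub>n u\<^sub>n\<close> is the finitely supported function \<open>n \<mapsto> f\<^sub>n\<close>.
  The coefficient of \<open>u\<^sub>n\<close> in a product collects the terms
  \<open>(f\<^sub>k u\<^sub>k) (g\<^sub>m u\<^sub>m) = f\<^sub>k \<sigma>\<^sub>k(g\<^sub>m) u\<^sub>k\<^sub>+\<^sub>m\<close> with \<open>m = n - k\<close>.\<close>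

definition skew_group_algebra ::
    "(complex, 'b) module \<Rightarrow> (int \<Rightarrow> 'b \<Rightarrow> 'b) \<Rightarrow> (complex, int \<Rightarrow> 'b) module" where
  "skew_group_algebra A \<sigma> =
    \<lparr> carrier = {F. (\<forall>n. F n \<in> carrier A) \<and> finite {n. F n \<noteq> \<zero>\<^bsub>A\<^esub>}},
      mult = (\<lambda>F G n. finsum A (\<lambda>k. F k \<otimes>\<^bsub>A\<^esub> \<sigma> k (G (n - k))) {k. F k \<noteq> \<zero>\<^bsub>A\<^esub>}),
      one = (\<lambda>n. if n = 0 then \<one>\<^bsub>A\<^esub> else \<zero>\<^bsub>A\<^esub>),
      zero = (\<lambda>n. \<zero>\<^bsub>A\<^esub>),
      add = (\<lambda>F G n. F n \<oplus>\<^bsub>A\<^esub> G n),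
      smult = (\<lambda>c F n. c \<odot>\<^bsub>A\<^esub> F n) \<rparr>"

definition monomial :: "(complex, 'b) module \<Rightarrow> 'b \<Rightarrow> int \<Rightarrow> (int \<Rightarrow> 'b)" where
  "monomial A f n = (\<lambda>m. if m = n then f else \<zero>\<^bsub>A\<^esub>)"

definition coefficient_copy :: "(complex, 'b) module \<Rightarrow> (int \<Rightarrow> 'b) set" where
  "coefficient_copy A = (\<lambda>f. monomial A f 0) ` carrier A"

abbreviation crossed_product ::
    "'a topology \<Rightarrow> ('a \<Rightarrow> 'a) \<Rightarrow> (complex, int \<Rightarrow> 'a \<Rightarrow> complex) module" where
  "crossed_product X h \<equiv> skew_group_algebra (cont_algebra X) (induced_action X h)"

text \<open>The locale \<open>ideal\<close> presupposes a ring, so simplicity would be vacuous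
  if these records were not rings.\<close>

lemma cont_algebra_simps [simp]:
  "carrier (cont_algebra X) = {f \<in> extensional (topspace X). continuous_map X euclidean f}"
  "f \<otimes>\<^bsub>cont_algebra X\<^esub> g = (\<lambda>x \<in> topspace X. f x * g x)"
  "\<one>\<^bsub>cont_algebra X\<^esub> = (\<lambda>x \<in> topspace X. 1)"
  "\<zero>\<^bsub>cont_algebra X\<^esub> = (\<lambda>x \<in> topspace X. 0)"
  "f \<oplus>\<^bsub>cont_algebra X\<^esub> g = (\<lambda>x \<in> topspace X. f x + g x)"
  "c \<odot>\<^bsub>cont_algebra X\<^esub> f = (\<lambda>x \<in> topspace X. c * f x)"
  by (simp_all add: cont_algebra_def)

lemma continuous_map_complex_mult:
  fixes f g :: "'a \<Rightarrow> complex"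
  assumes "continuous_map X euclidean f" "continuous_map X euclidean g"
  shows "continuous_map X euclidean (\<lambda>x. f x * g x)"
  using assms by (simp add: continuous_map_atin tendsto_mult)

lemma continuous_map_restrict_topspace:
  "continuous_map X Y (restrict f (topspace X)) \<longleftrightarrow> continuous_map X Y f"
  by (rule iffI; erule continuous_map_eq) auto

lemma cring_cont_algebra: "cring (cont_algebra X)"
proof (intro cringI abelian_groupI comm_monoidI)
  fix f assume f: "f \<in> carrier (cont_algebra X)"
  let ?g = "\<lambda>x \<in> topspace X. - f x"
  have "?g \<in> carrier (cont_algebra X)"
    using f by (simp add: continuous_map_restrict_topspace continuous_map_minus)
  moreover have "?g \<oplus>\<^bsub>cont_algebra X\<^esub> f = \<zero>\<^bsub>cont_algebra X\<^esub>"
    by (auto simp: fun_eq_iff)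
  ultimately show "\<exists>g \<in> carrier (cont_algebra X). g \<oplus>\<^bsub>cont_algebra X\<^esub> f = \<zero>\<^bsub>cont_algebra X\<^esub>"
    by blast
qed (auto simp: continuous_map_restrict_topspace continuous_map_add
      continuous_map_complex_mult fun_eq_iff algebra_simps extensional_def)

lemma finsum_cont_algebra:
  assumes "finite S" "\<And>k. k \<in> S \<Longrightarrow> f k \<in> carrier (cont_algebra X)"
  shows "finsum (cont_algebra X) f S = (\<lambda>x \<in> topspace X. \<Sum>k\<in>S. f k x)"
proof -
  interpret cring "cont_algebra X" by (rule cring_cont_algebra)
  show ?thesis
    using assms
  proof (induction S)
    case (insert k S)
    then have "finsum (cont_algebra X) f (insert k S) = f k \<oplus>\<^bsub>cont_algebra X\<^esub> finsum (cont_algebra X) f S"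
      by (intro finsum_insert) (blast intro: insert.prems)+
    also have "\<dots> = (\<lambda>x \<in> topspace X. \<Sum>k\<in>insert k S. f k x)"
      using insert by (auto simp: fun_eq_iff)
    finally show ?case .
  qed simp
qed

context
  fixes X :: "'a topology" and h :: "'a \<Rightarrow> 'a"
  assumes sys: "topological_dynamical_system X h"
begin

lemma homeo: "homeomorphic_map X X h"
  using sys by (simp add: topological_dynamical_system_def)

lemma homeo_bij: "bij_betw h (topspace X) (topspace X)"
  using homeo by (simp add: bij_betw_def homeomorphic_eq_everything_map)

lemma homeo_inv: "homeomorphic_map X X (inv_into (topspace X) h)"
proof -
  obtain g where g: "homeomorphic_maps X X h g"
    using homeo homeomorphic_map_maps by blast
  then have "homeomorphic_map X X g"
    using homeomorphic_maps_map by blast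
  moreover have "g x = inv_into (topspace X) h x" if "x \<in> topspace X" for x
    using g that homeo_bij unfolding homeomorphic_maps_def
    by (metis bij_betw_def continuous_map_image_subset_topspace image_subset_iff inv_into_f_f)
  ultimately show ?thesis
    by (rule homeomorphic_map_eq)
qed

lemma continuous_map_iterate: "continuous_map X X (iterate X h n)"
proof -
  have "continuous_map X X (f ^^ m)" if "continuous_map X X f" for f :: "'a \<Rightarrow> 'a" and m
    using that by (induction m) (auto intro: continuous_map_compose simp del: o_apply)
  then show ?thesis
    unfolding iterate_def
    using homeomorphic_imp_continuous_map[OF homeo] homeomorphic_imp_continuous_map[OF homeo_inv]
    by (simp split: if_split)
qed

lemma iterate_in: "x \<in> topspace X \<Longrightarrow> iterate X h n x \<in> topspace X"
  using continuous_map_iterate by (auto simp: continuous_map_def)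

lemma iterate_0 [simp]: "iterate X h 0 x = x"
  by (simp add: iterate_def)

lemma iterate_succ:
  assumes "x \<in> topspace X"
  shows "iterate X h (n + 1) x = h (iterate X h n x)"
proof (cases "0 \<le> n")
  case True
  then show ?thesis by (simp add: iterate_def nat_add_distrib)
next
  case False
  then obtain m where m: "n = - int (Suc m)"
    by (metis add.commute int_cases linorder_not_le nat_less_le not_le of_nat_0_le_iff)
  let ?g = "inv_into (topspace X) h"
  have e: "iterate X h (- int m) x = (?g ^^ m) x"
    by (cases "m = 0") (simp_all add: iterate_def)
  have "h (iterate X h n x) = h (?g ((?g ^^ m) x))"
    unfolding iterate_def m minus_minus nat_int by simp
  also have "\<dots> = (?g ^^ m) x"
    using homeo_bij iterate_in[OF assms, of "- int m"] e
    by (metis bij_betw_inv_into_right)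
  finally show ?thesis using m e by simp
qed

lemma iterate_add:
  assumes "x \<in> topspace X"
  shows "iterate X h (m + n) x = iterate X h m (iterate X h n x)"
proof (induction m rule: int_induct[where k = 0])
  case (step1 i)
  have "iterate X h (i + 1 + n) x = h (iterate X h (i + n) x)"
    using iterate_succ[OF assms, of "i + n"] by (simp add: ac_simps)
  then show ?case
    using step1 iterate_succ[OF iterate_in[OF assms]] by simp
next
  case (step2 i)
  have "h (iterate X h (i - 1 + n) x) = h (iterate X h (i - 1) (iterate X h n x))"
    using iterate_succ[OF assms, of "i - 1 + n"] step2
      iterate_succ[OF iterate_in[OF assms], of "i - 1"]
    by (simp add: algebra_simps)
  then show ?case
    using homeo_bij assms by (auto simp: bij_betw_def inj_on_def iterate_in)
qed simp

lemma induced_action_closed: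
  "f \<in> carrier (cont_algebra X) \<Longrightarrow> induced_action X h n f \<in> carrier (cont_algebra X)"
  using continuous_map_compose[OF continuous_map_iterate]
  by (auto simp: induced_action_def compose_def continuous_map_restrict_topspace o_def)

private abbreviation (input) "CX \<equiv> cont_algebra X"
private abbreviation (input) "A \<equiv> crossed_product X h"

lemma crossed_product_mult:
  assumes F: "F \<in> carrier A" and G: "G \<in> carrier A"
    and S: "finite S" "{k. F k \<noteq> \<zero>\<^bsub>CX\<^esub>} \<subseteq> S"
  shows "(F \<otimes>\<^bsub>A\<^esub> G) n = (\<lambda>x \<in> topspace X. \<Sum>k\<in>S. F k x * G (n - k) (iterate X h k x))"
proof -
  interpret cring CX by (rule cring_cont_algebra)
  have cl: "F k \<otimes>\<^bsub>CX\<^esub> induced_action X h k (G m) \<in> carrier CX" for k m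
    using F G by (intro m_closed induced_action_closed) (auto simp: skew_group_algebra_def)
  have "(F \<otimes>\<^bsub>A\<^esub> G) n = (\<lambda>x \<in> topspace X. \<Sum>k\<in>{k. F k \<noteq> \<zero>\<^bsub>CX\<^esub>}.
      (F k \<otimes>\<^bsub>CX\<^esub> induced_action X h k (G (n - k))) x)"
    unfolding skew_group_algebra_def monoid.simps
    using F by (intro finsum_cont_algebra cl) (simp add: skew_group_algebra_def)
  also have "\<dots> = (\<lambda>x \<in> topspace X. \<Sum>k\<in>S. F k x * G (n - k) (iterate X h k x))"
  proof (rule restrict_ext)
    fix x assume x: "x \<in> topspace X"
    have "(\<Sum>k\<in>{k. F k \<noteq> \<zero>\<^bsub>CX\<^esub>}. (F k \<otimes>\<^bsub>CX\<^esub> induced_action X h k (G (n - k))) x)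
        = (\<Sum>k\<in>{k. F k \<noteq> \<zero>\<^bsub>CX\<^esub>}. F k x * G (n - k) (iterate X h k x))"
      using x by (intro sum.cong) (auto simp: induced_action_def compose_def)
    also have "\<dots> = (\<Sum>k\<in>S. F k x * G (n - k) (iterate X h k x))"
      using S x by (intro sum.mono_neutral_left) auto
    finally show "(\<Sum>k\<in>{k. F k \<noteq> \<zero>\<^bsub>CX\<^esub>}. (F k \<otimes>\<^bsub>CX\<^esub> induced_action X h k (G (n - k))) x)
        = (\<Sum>k\<in>S. F k x * G (n - k) (iterate X h k x))" .
  qed
  finally show ?thesis .
qed

lemma crossed_product_mult_support:
  assumes F: "F \<in> carrier A" and G: "G \<in> carrier A"
  shows "{n. (F \<otimes>\<^bsub>A\<^esub> G) n \<noteq> \<zero>\<^bsub>CX\<^esub>} \<subseteq>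
    (\<lambda>(i, j). i + j) ` ({k. F k \<noteq> \<zero>\<^bsub>CX\<^esub>} \<times> {k. G k \<noteq> \<zero>\<^bsub>CX\<^esub>})" (is "_ \<subseteq> ?S")
proof -
  have "(F \<otimes>\<^bsub>A\<^esub> G) n = \<zero>\<^bsub>CX\<^esub>" if n: "n \<notin> ?S" for n
  proof -
    have G0: "G (n - k) = \<zero>\<^bsub>CX\<^esub>" if "F k \<noteq> \<zero>\<^bsub>CX\<^esub>" for k
      using n that by (auto simp: image_iff) (metis add.commute diff_add_cancel)
    have "(F \<otimes>\<^bsub>A\<^esub> G) n
      = (\<lambda>x \<in> topspace X. \<Sum>k\<in>{k. F k \<noteq> \<zero>\<^bsub>CX\<^esub>}. F k x * G (n - k) (iterate X h k x))"
      using F by (intro crossed_product_mult[OF F G]) (auto simp: skew_group_algebra_def)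
    also have "\<dots> = (\<lambda>x \<in> topspace X. 0)"
      using G0 by (intro restrict_ext sum.neutral) (auto simp: iterate_in)
    finally show ?thesis by simp
  qed
  then show ?thesis by blast
qed

lemma crossed_product_mult_closed:
  assumes F: "F \<in> carrier A" and G: "G \<in> carrier A"
  shows "F \<otimes>\<^bsub>A\<^esub> G \<in> carrier A"
proof -
  interpret cring CX by (rule cring_cont_algebra)
  have "(F \<otimes>\<^bsub>A\<^esub> G) n \<in> carrier CX" for n
    unfolding skew_group_algebra_def monoid.simps
    using F G by (intro finsum_closed Pi_I m_closed induced_action_closed)
      (auto simp: skew_group_algebra_def)
  moreover have "finite {n. (F \<otimes>\<^bsub>A\<^esub> G) n \<noteq> \<zero>\<^bsub>CX\<^esub>}"
    using F G by (intro finite_subset[OF crossed_product_mult_support[OF F G]])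
      (auto simp: skew_group_algebra_def)
  ultimately show ?thesis by (simp add: skew_group_algebra_def)
qed

lemma crossed_product_add_closed:
  assumes F: "F \<in> carrier A" and G: "G \<in> carrier A"
  shows "F \<oplus>\<^bsub>A\<^esub> G \<in> carrier A"
proof -
  interpret cring CX by (rule cring_cont_algebra)
  have "{n. F n \<oplus>\<^bsub>CX\<^esub> G n \<noteq> \<zero>\<^bsub>CX\<^esub>} \<subseteq> {n. F n \<noteq> \<zero>\<^bsub>CX\<^esub>} \<union> {n. G n \<noteq> \<zero>\<^bsub>CX\<^esub>}"
    by (auto simp del: cont_algebra_simps)
  then have "finite {n. F n \<oplus>\<^bsub>CX\<^esub> G n \<noteq> \<zero>\<^bsub>CX\<^esub>}"
    by (rule finite_subset) (use F G in \<open>simp add: skew_group_algebra_def\<close>)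
  then show ?thesis
    using F G by (simp add: skew_group_algebra_def del: cont_algebra_simps)
qed

lemma ext_carrier:
  assumes "F \<in> carrier A" "G \<in> carrier A"
    and "\<And>n x. x \<in> topspace X \<Longrightarrow> F n x = G n x"
  shows "F = G"
proof
  fix n show "F n = G n"
    using assms by (intro extensionalityI[of _ "topspace X"]) (auto simp: skew_group_algebra_def)
qed

lemma crossed_product_mult_apply:
  assumes "F \<in> carrier A" "G \<in> carrier A" "finite S" "{k. F k \<noteq> \<zero>\<^bsub>CX\<^esub>} \<subseteq> S" "x \<in> topspace X"
  shows "(F \<otimes>\<^bsub>A\<^esub> G) n x = (\<Sum>k\<in>S. F k x * G (n - k) (iterate X h k x))"
  using crossed_product_mult[OF assms(1-4)] assms(5) by simp

lemma carrier_support: "F \<in> carrier A \<Longrightarrow> finite {k. F k \<noteq> \<zero>\<^bsub>CX\<^esub>}"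
  by (simp add: skew_group_algebra_def)

lemma monomial_carrier: "f \<in> carrier CX \<Longrightarrow> monomial CX f n \<in> carrier A"
proof -
  assume f: "f \<in> carrier CX"
  interpret cring CX by (rule cring_cont_algebra)
  have "finite {m. monomial CX f n m \<noteq> \<zero>\<^bsub>CX\<^esub>}"
    by (rule finite_subset[of _ "{n}"]) (auto simp: monomial_def)
  then show ?thesis
    using f by (simp add: skew_group_algebra_def monomial_def del: cont_algebra_simps)
qed

lemma one_monomial: "\<one>\<^bsub>A\<^esub> = monomial CX \<one>\<^bsub>CX\<^esub> 0"
  by (auto simp: skew_group_algebra_def monomial_def fun_eq_iff)

lemma add_apply: "x \<in> topspace X \<Longrightarrow> (F \<oplus>\<^bsub>A\<^esub> G) n x = F n x + G n x"
  by (simp add: skew_group_algebra_def)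

lemma crossed_product_assoc:
  assumes F: "F \<in> carrier A" and G: "G \<in> carrier A" and H: "H \<in> carrier A"
  shows "(F \<otimes>\<^bsub>A\<^esub> G) \<otimes>\<^bsub>A\<^esub> H = F \<otimes>\<^bsub>A\<^esub> (G \<otimes>\<^bsub>A\<^esub> H)"
proof (rule ext_carrier)
  fix n x assume x: "x \<in> topspace X"
  define P where "P = {k. F k \<noteq> \<zero>\<^bsub>CX\<^esub>}"
  define Q where "Q = {k. G k \<noteq> \<zero>\<^bsub>CX\<^esub>}"
  define S where "S = (\<lambda>(i, j). i + j) ` (P \<times> Q)"
  have fin: "finite P" "finite Q" "finite S"
    using F G by (auto simp: P_def Q_def S_def skew_group_algebra_def)
  have "((F \<otimes>\<^bsub>A\<^esub> G) \<otimes>\<^bsub>A\<^esub> H) n x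
      = (\<Sum>k\<in>S. (F \<otimes>\<^bsub>A\<^esub> G) k x * H (n - k) (iterate X h k x))"
    using crossed_product_mult_support[OF F G] fin x
    by (intro crossed_product_mult_apply crossed_product_mult_closed F G H) (simp_all add: S_def P_def Q_def)
  also have "\<dots> = (\<Sum>k\<in>S. \<Sum>j\<in>P. F j x * G (k - j) (iterate X h j x) * H (n - k) (iterate X h k x))"
    using crossed_product_mult_apply[OF F G fin(1) _ x]
    by (intro sum.cong refl) (simp add: P_def sum_distrib_right)
  also have "\<dots> = (\<Sum>j\<in>P. \<Sum>k\<in>S. F j x * G (k - j) (iterate X h j x) * H (n - k) (iterate X h k x))"
    by (rule sum.swap)
  also have "\<dots> = (\<Sum>j\<in>P. \<Sum>i\<in>Q. F j x * G i (iterate X h j x) * H (n - j - i) (iterate X h i (iterate X h j x)))"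
  proof (rule sum.cong[OF refl])
    fix j assume j: "j \<in> P"
    have "(\<Sum>k\<in>S. F j x * G (k - j) (iterate X h j x) * H (n - k) (iterate X h k x))
        = (\<Sum>k\<in>(\<lambda>i. i + j) ` Q. F j x * G (k - j) (iterate X h j x) * H (n - k) (iterate X h k x))"
    proof (rule sum.mono_neutral_right[OF fin(3)])
      show "(\<lambda>i. i + j) ` Q \<subseteq> S"
        using j by (auto simp: S_def image_iff) (metis add.commute)
      have "G (k - j) (iterate X h j x) = 0" if "k \<notin> (\<lambda>i. i + j) ` Q" for k
      proof -
        have "k - j \<notin> Q" using that by (metis diff_add_cancel image_eqI)
        then show ?thesis using iterate_in[OF x] by (simp add: Q_def)
      qed
      then show "\<forall>k\<in>S - (\<lambda>i. i + j) ` Q.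
          F j x * G (k - j) (iterate X h j x) * H (n - k) (iterate X h k x) = 0"
        by simp
    qed
    also have "\<dots> = (\<Sum>i\<in>Q. F j x * G i (iterate X h j x) * H (n - j - i) (iterate X h i (iterate X h j x)))"
      by (subst sum.reindex) (auto simp: iterate_add[OF x] algebra_simps intro!: sum.cong)
    finally show "(\<Sum>k\<in>S. F j x * G (k - j) (iterate X h j x) * H (n - k) (iterate X h k x)) = \<dots>" .
  qed
  also have "\<dots> = (\<Sum>j\<in>P. F j x * (G \<otimes>\<^bsub>A\<^esub> H) (n - j) (iterate X h j x))"
    using crossed_product_mult_apply[OF G H fin(2) _ iterate_in[OF x]]
    by (intro sum.cong refl) (simp add: Q_def sum_distrib_left mult.assoc)
  also have "\<dots> = (F \<otimes>\<^bsub>A\<^esub> (G \<otimes>\<^bsub>A\<^esub> H)) n x"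
    using fin x
    by (intro crossed_product_mult_apply[symmetric] crossed_product_mult_closed F G H) (simp_all add: P_def)
  finally show "((F \<otimes>\<^bsub>A\<^esub> G) \<otimes>\<^bsub>A\<^esub> H) n x = (F \<otimes>\<^bsub>A\<^esub> (G \<otimes>\<^bsub>A\<^esub> H)) n x" .
qed (intro crossed_product_mult_closed assms)+

lemma monomial_mult:
  assumes f: "f \<in> carrier CX" and g: "g \<in> carrier CX"
  shows "monomial CX f n \<otimes>\<^bsub>A\<^esub> monomial CX g m
    = monomial CX (f \<otimes>\<^bsub>CX\<^esub> induced_action X h n g) (n + m)"
proof (rule ext_carrier)
  interpret cring CX by (rule cring_cont_algebra)
  have fg: "f \<otimes>\<^bsub>CX\<^esub> induced_action X h n g \<in> carrier CX"
    by (intro m_closed induced_action_closed f g)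
  show "monomial CX f n \<otimes>\<^bsub>A\<^esub> monomial CX g m \<in> carrier A"
    by (intro crossed_product_mult_closed monomial_carrier f g)
  show "monomial CX (f \<otimes>\<^bsub>CX\<^esub> induced_action X h n g) (n + m) \<in> carrier A"
    by (rule monomial_carrier[OF fg])
  fix k x assume x: "x \<in> topspace X"
  have "(monomial CX f n \<otimes>\<^bsub>A\<^esub> monomial CX g m) k x
      = (\<Sum>i\<in>{n}. monomial CX f n i x * monomial CX g m (k - i) (iterate X h i x))"
    by (intro crossed_product_mult_apply monomial_carrier f g x) (auto simp: monomial_def)
  then show "(monomial CX f n \<otimes>\<^bsub>A\<^esub> monomial CX g m) k x
      = monomial CX (f \<otimes>\<^bsub>CX\<^esub> induced_action X h n g) (n + m) k x"
    using x by (auto simp: monomial_def induced_action_def compose_def iterate_in)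
qed

lemma ring_crossed_product: "ring (crossed_product X h)"
proof (intro ringI abelian_groupI monoidI)
  interpret cring CX by (rule cring_cont_algebra)
  show one: "\<one>\<^bsub>A\<^esub> \<in> carrier A"
    unfolding one_monomial by (rule monomial_carrier[OF one_closed])
  show zero: "\<zero>\<^bsub>A\<^esub> \<in> carrier A"
    using zero_closed by (simp add: skew_group_algebra_def del: cont_algebra_simps)
  fix F assume F: "F \<in> carrier A"
  show "\<zero>\<^bsub>A\<^esub> \<oplus>\<^bsub>A\<^esub> F = F"
    by (intro ext_carrier crossed_product_add_closed F zero) (simp add: skew_group_algebra_def)
  show "\<one>\<^bsub>A\<^esub> \<otimes>\<^bsub>A\<^esub> F = F"
  proof (intro ext_carrier crossed_product_mult_closed F one)
    fix n x assume x: "x \<in> topspace X"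
    have "(\<one>\<^bsub>A\<^esub> \<otimes>\<^bsub>A\<^esub> F) n x = (\<Sum>k\<in>{0}. \<one>\<^bsub>A\<^esub> k x * F (n - k) (iterate X h k x))"
      by (intro crossed_product_mult_apply one F x) (auto simp: one_monomial monomial_def)
    then show "(\<one>\<^bsub>A\<^esub> \<otimes>\<^bsub>A\<^esub> F) n x = F n x"
      using x by (simp add: one_monomial monomial_def)
  qed
  show "F \<otimes>\<^bsub>A\<^esub> \<one>\<^bsub>A\<^esub> = F"
  proof (intro ext_carrier crossed_product_mult_closed F one)
    fix n x assume x: "x \<in> topspace X"
    let ?S = "insert n {k. F k \<noteq> \<zero>\<^bsub>CX\<^esub>}"
    have "(F \<otimes>\<^bsub>A\<^esub> \<one>\<^bsub>A\<^esub>) n x = (\<Sum>k\<in>?S. F k x * \<one>\<^bsub>A\<^esub> (n - k) (iterate X h k x))"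
      using carrier_support[OF F] by (intro crossed_product_mult_apply one F x) auto
    also have "\<dots> = (\<Sum>k\<in>{n}. F k x * \<one>\<^bsub>A\<^esub> (n - k) (iterate X h k x))"
      using carrier_support[OF F] x
      by (intro sum.mono_neutral_right) (auto simp: one_monomial monomial_def iterate_in)
    also have "\<dots> = F n x"
      using x by (simp add: one_monomial monomial_def iterate_in)
    finally show "(F \<otimes>\<^bsub>A\<^esub> \<one>\<^bsub>A\<^esub>) n x = F n x" .
  qed
  show "\<exists>G \<in> carrier A. G \<oplus>\<^bsub>A\<^esub> F = \<zero>\<^bsub>A\<^esub>"
  proof (rule bexI)
    let ?G = "\<lambda>n. \<ominus>\<^bsub>CX\<^esub> F n"
    have cl: "F n \<in> carrier CX" for n using F by (simp add: skew_group_algebra_def)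
    have "{n. ?G n \<noteq> \<zero>\<^bsub>CX\<^esub>} \<subseteq> {n. F n \<noteq> \<zero>\<^bsub>CX\<^esub>}"
      by (auto simp del: cont_algebra_simps)
    then have "finite {n. ?G n \<noteq> \<zero>\<^bsub>CX\<^esub>}"
      using carrier_support[OF F] by (rule finite_subset)
    then show "?G \<in> carrier A"
      using cl by (simp add: skew_group_algebra_def del: cont_algebra_simps)
    show "?G \<oplus>\<^bsub>A\<^esub> F = \<zero>\<^bsub>A\<^esub>"
      using l_neg[OF cl] by (simp add: skew_group_algebra_def del: cont_algebra_simps)
  qed
  fix G assume G: "G \<in> carrier A"
  show "F \<oplus>\<^bsub>A\<^esub> G \<in> carrier A" by (intro crossed_product_add_closed F G)
  show "F \<otimes>\<^bsub>A\<^esub> G \<in> carrier A" by (intro crossed_product_mult_closed F G)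
  show "F \<oplus>\<^bsub>A\<^esub> G = G \<oplus>\<^bsub>A\<^esub> F"
    by (intro ext_carrier crossed_product_add_closed F G) (simp add: add_apply)
  fix H assume H: "H \<in> carrier A"
  show "(F \<oplus>\<^bsub>A\<^esub> G) \<oplus>\<^bsub>A\<^esub> H = F \<oplus>\<^bsub>A\<^esub> (G \<oplus>\<^bsub>A\<^esub> H)"
    by (intro ext_carrier crossed_product_add_closed F G H) (simp add: add_apply)
  show "(F \<otimes>\<^bsub>A\<^esub> G) \<otimes>\<^bsub>A\<^esub> H = F \<otimes>\<^bsub>A\<^esub> (G \<otimes>\<^bsub>A\<^esub> H)"
    by (intro crossed_product_assoc F G H)
  have FG: "F \<oplus>\<^bsub>A\<^esub> G \<in> carrier A" by (intro crossed_product_add_closed F G)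
  show "(F \<oplus>\<^bsub>A\<^esub> G) \<otimes>\<^bsub>A\<^esub> H = F \<otimes>\<^bsub>A\<^esub> H \<oplus>\<^bsub>A\<^esub> G \<otimes>\<^bsub>A\<^esub> H"
  proof (intro ext_carrier crossed_product_mult_closed crossed_product_add_closed F G H)
    fix n x assume x: "x \<in> topspace X"
    let ?S = "{k. F k \<noteq> \<zero>\<^bsub>CX\<^esub>} \<union> {k. G k \<noteq> \<zero>\<^bsub>CX\<^esub>} \<union> {k. (F \<oplus>\<^bsub>A\<^esub> G) k \<noteq> \<zero>\<^bsub>CX\<^esub>}"
    have S: "finite ?S" using carrier_support F G FG by blast
    show "((F \<oplus>\<^bsub>A\<^esub> G) \<otimes>\<^bsub>A\<^esub> H) n x = (F \<otimes>\<^bsub>A\<^esub> H \<oplus>\<^bsub>A\<^esub> G \<otimes>\<^bsub>A\<^esub> H) n x"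
      unfolding add_apply[OF x] crossed_product_mult_apply[OF FG H S Un_upper2 x]
      apply (subst crossed_product_mult_apply[OF F H S _ x], blast)
      apply (subst crossed_product_mult_apply[OF G H S _ x], blast)
      by (simp add: add_apply[OF x] sum.distrib algebra_simps)
  qed
  have FG: "F \<oplus>\<^bsub>A\<^esub> G \<in> carrier A" by (intro crossed_product_add_closed F G)
  show "H \<otimes>\<^bsub>A\<^esub> (F \<oplus>\<^bsub>A\<^esub> G) = H \<otimes>\<^bsub>A\<^esub> F \<oplus>\<^bsub>A\<^esub> H \<otimes>\<^bsub>A\<^esub> G"
  proof (intro ext_carrier crossed_product_mult_closed crossed_product_add_closed F G H)
    fix n x assume x: "x \<in> topspace X"
    note S = carrier_support[OF H]
    show "(H \<otimes>\<^bsub>A\<^esub> (F \<oplus>\<^bsub>A\<^esub> G)) n x = (H \<otimes>\<^bsub>A\<^esub> F \<oplus>\<^bsub>A\<^esub> H \<otimes>\<^bsub>A\<^esub> G) n x"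
      unfolding add_apply[OF x] crossed_product_mult_apply[OF H FG S subset_refl x]
        crossed_product_mult_apply[OF H F S subset_refl x]
        crossed_product_mult_apply[OF H G S subset_refl x]
      using x by (simp add: add_apply iterate_in sum.distrib algebra_simps)
  qed
qed

end

end

theory Submission
  imports Defs
begin

text \<open>
  Write \<open>\<sigma>\<^sub>n f = f \<circ> h\<^sup>n\<close> and let \<open>A\<close> be the crossed product. The three conditions are linked through
  two properties of the dynamics: \<open>\<int>\<close>-simplicity of \<open>C(X)\<close> and freeness of the action of \<open>\<int>\<close> on \<open>X\<close>.

  \<^item> \<open>C(X)\<close> is \<open>\<int>\<close>-simple iff the system is minimal. The functions vanishing on an orbit form an
    invariant ideal, which is proper and, if the orbit is not dense, nonzero by complete regularity.
    Conversely, let \<open>p \<noteq> 0\<close> lie in an invariant ideal. If all orbits are dense, the sets on which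
    \<open>\<sigma>\<^sub>n p\<close> does not vanish cover \<open>X\<close>. By compactness finitely many of them do, and then the finite
    sum of the functions \<open>\<bar>\<sigma>\<^sub>n p\<bar>\<^sup>2\<close> is a unit that belongs to the ideal.
  \<^item> On an infinite space a minimal action is free, because the orbit of a periodic point is finite,
    hence closed.
  \<^item> If the action is free, bump functions \<open>f\<close> with \<open>f(x) = 1\<close> separate \<open>x\<close> from its translates.
    Comparing \<open>f F\<close> and \<open>F f\<close> shows that an element \<open>F\<close> commuting with \<open>C(X)\<close>
    has no nonzero coefficient outside degree \<open>0\<close>, so \<open>C(X)\<close> is maximal commutative. If \<open>F\<close> is a nonzero
    element of an ideal, shifted so that \<open>F\<^sub>0(x) \<noteq> 0\<close>, and the support of \<open>f\<close> is so small that it is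
    disjoint from its finitely many relevant translates, then \<open>f F f = f\<^sup>2 F\<^sub>0\<close> is a nonzero element
    of \<open>C(X)\<close> in that ideal. Hence a nonzero ideal of \<open>A\<close> meets \<open>C(X)\<close> in a nonzero invariant
    ideal, and \<open>\<int>\<close>-simplicity yields simplicity of \<open>A\<close>.
  \<^item> Conversely, an invariant ideal \<open>J\<close> of \<open>C(X)\<close> gives the ideal of \<open>A\<close> consisting of the sums whose
    coefficients all lie in \<open>J\<close>, so simplicity of \<open>A\<close> implies \<open>\<int>\<close>-simplicity of \<open>C(X)\<close>.
\<close>

section \<open>Ideals and commutants in rings\<close>

text \<open>Additive inverses come for free from multiplication by \<open>\<ominus> \<one>\<close>.\<close>

lemma (in ring) idealI_no_inverse:
  assumes "I \<subseteq> carrier R" "\<zero> \<in> I"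
    and add: "\<And>a b. a \<in> I \<Longrightarrow> b \<in> I \<Longrightarrow> a \<oplus> b \<in> I"
    and l: "\<And>a x. a \<in> I \<Longrightarrow> x \<in> carrier R \<Longrightarrow> x \<otimes> a \<in> I"
    and r: "\<And>a x. a \<in> I \<Longrightarrow> x \<in> carrier R \<Longrightarrow> a \<otimes> x \<in> I"
  shows "ideal I R"
proof (rule idealI[OF ring_axioms _ l r])
  show "subgroup I (add_monoid R)"
  proof (rule add.subgroupI)
    fix a assume a: "a \<in> I"
    then have "\<ominus> a = \<ominus> \<one> \<otimes> a"
      using assms(1) by (simp add: subset_iff l_minus)
    then show "\<ominus> a \<in> I"
      using l[OF a, of "\<ominus> \<one>"] by simp
  qed (use assms in auto)
qed

lemma (in ideal) finsum_in_ideal: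
  assumes "\<And>k. k \<in> S \<Longrightarrow> f k \<in> I"
  shows "finsum R f S \<in> I"
  using assms
proof (induction S rule: infinite_finite_induct)
  case (insert k S)
  then show ?case
    using a_subset by (subst finsum_insert) auto
qed auto

lemma (in ring) subring_commutant:
  fixes B :: "'a set"
  assumes "B \<subseteq> carrier R"
  shows "subring {a \<in> carrier R. \<forall>b \<in> B. a \<otimes> b = b \<otimes> a} R"
proof (rule subringI)
  fix a c
  assume "a \<in> {a \<in> carrier R. \<forall>b \<in> B. a \<otimes> b = b \<otimes> a}" "c \<in> {a \<in> carrier R. \<forall>b \<in> B. a \<otimes> b = b \<otimes> a}"
  then have ac: "a \<in> carrier R" "c \<in> carrier R"
    "\<And>b. b \<in> B \<Longrightarrow> a \<otimes> b = b \<otimes> a" "\<And>b. b \<in> B \<Longrightarrow> c \<otimes> b = b \<otimes> c" by auto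
  have "(a \<otimes> c) \<otimes> b = b \<otimes> (a \<otimes> c)" if "b \<in> B" for b
  proof -
    have b: "b \<in> carrier R" using that assms by blast
    have "(a \<otimes> c) \<otimes> b = a \<otimes> (b \<otimes> c)" using ac b that by (simp add: m_assoc)
    also have "\<dots> = b \<otimes> (a \<otimes> c)" using ac b that by (simp add: m_assoc[symmetric])
    finally show ?thesis .
  qed
  then show "a \<otimes> c \<in> {a \<in> carrier R. \<forall>b \<in> B. a \<otimes> b = b \<otimes> a}"
    using ac by blast
  show "a \<oplus> c \<in> {a \<in> carrier R. \<forall>b \<in> B. a \<otimes> b = b \<otimes> a}"
    using ac assms by (auto simp: l_distr r_distr subset_iff)
qed (use assms in \<open>auto simp: l_minus r_minus subset_iff\<close>)

section \<open>Functions on the space and elements of the crossed product\<close>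

definition free_action :: "'a topology \<Rightarrow> ('a \<Rightarrow> 'a) \<Rightarrow> bool" where
  "free_action X h \<longleftrightarrow> (\<forall>x \<in> topspace X. \<forall>n. n \<noteq> 0 \<longrightarrow> iterate X h n x \<noteq> x)"

context
  fixes X :: "'a topology" and h :: "'a \<Rightarrow> 'a"
  assumes sys: "topological_dynamical_system X h"
begin

private abbreviation (input) "CX \<equiv> cont_algebra X"
private abbreviation (input) "A \<equiv> crossed_product X h"
private abbreviation (input) "it \<equiv> iterate X h"

interpretation CX: cring "cont_algebra X" by (rule cring_cont_algebra)
interpretation A: ring "crossed_product X h" by (rule ring_crossed_product[OF sys])

lemma bump_function:
  assumes "openin X U" "x \<in> U"
  obtains f where "f \<in> carrier CX" "f x = 1" "\<And>y. y \<in> topspace X \<Longrightarrow> y \<notin> U \<Longrightarrow> f y = 0"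
proof -
  have "completely_regular_space X"
    using sys unfolding topological_dynamical_system_def
    by (intro normal_imp_completely_regular_space compact_Hausdorff_or_regular_imp_normal_space) auto
  then obtain g where g: "continuous_map X euclideanreal g" "g x = 0" "g ` (topspace X - U) \<subseteq> {1}"
    using assms unfolding completely_regular_space_alt' by blast
  let ?f = "\<lambda>y \<in> topspace X. complex_of_real (1 - g y)"
  have "continuous_map X euclidean (complex_of_real \<circ> (\<lambda>y. 1 - g y))"
    by (rule continuous_map_compose[of _ euclideanreal])
      (use g in \<open>auto intro!: continuous_map_diff continuous_intros simp: continuous_map_iff_continuous2\<close>)
  then have "?f \<in> carrier CX"
    by (simp add: continuous_map_restrict_topspace o_def)
  moreover have "x \<in> topspace X" using assms openin_subset by blast
  ultimately show ?thesis
    using g by (intro that[of ?f]) auto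
qed

lemma CX_eqI:
  assumes "f \<in> carrier CX" "g \<in> carrier CX" "\<And>x. x \<in> topspace X \<Longrightarrow> f x = g x"
  shows "f = g"
  using assms by (intro extensionalityI[of _ "topspace X"]) auto

lemma CX_nonzero:
  assumes "f \<in> carrier CX" "f \<noteq> \<zero>\<^bsub>CX\<^esub>"
  obtains x where "x \<in> topspace X" "f x \<noteq> 0"
  using CX_eqI[OF assms(1) CX.zero_closed] assms(2) by auto

lemma CX_unit:
  assumes f: "f \<in> carrier CX" and nz: "\<And>x. x \<in> topspace X \<Longrightarrow> f x \<noteq> 0"
  obtains g where "g \<in> carrier CX" "g \<otimes>\<^bsub>CX\<^esub> f = \<one>\<^bsub>CX\<^esub>"
proof -
  have "continuous_map X euclidean (\<lambda>x. inverse (f x))"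
    using f nz by (auto simp: continuous_map_atin intro!: tendsto_inverse)
  then show ?thesis
    using nz by (intro that[of "\<lambda>x \<in> topspace X. inverse (f x)"])
      (auto simp: continuous_map_restrict_topspace)
qed

lemma CX_cnj: "f \<in> carrier CX \<Longrightarrow> (\<lambda>x \<in> topspace X. cnj (f x)) \<in> carrier CX"
  using continuous_map_compose[of X euclidean f euclidean cnj]
  by (simp add: continuous_map_restrict_topspace continuous_map_iff_continuous2 continuous_on_cnj o_def)

text \<open>Scalar multiples are products with constant functions.\<close>

lemma algebra_ideal_CX_iff: "algebra_ideal I CX \<longleftrightarrow> ideal I CX"
proof -
  have "c \<odot>\<^bsub>CX\<^esub> f \<in> I" if I: "ideal I CX" and f: "f \<in> I" for c f
  proof -
    have "(\<lambda>x \<in> topspace X. c) \<otimes>\<^bsub>CX\<^esub> f \<in> I"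
      by (rule ideal.I_l_closed[OF I f]) (simp add: continuous_map_restrict_topspace)
    moreover have "(\<lambda>x \<in> topspace X. c) \<otimes>\<^bsub>CX\<^esub> f = c \<odot>\<^bsub>CX\<^esub> f"
      by (auto simp: fun_eq_iff)
    ultimately show ?thesis by simp
  qed
  then show ?thesis by (auto simp: algebra_ideal_def)
qed

lemma induced_action_apply: "x \<in> topspace X \<Longrightarrow> induced_action X h n f x = f (it n x)"
  by (simp add: induced_action_def compose_def)

lemma coefficient_closed: "F \<in> carrier A \<Longrightarrow> F n \<in> carrier CX"
  by (simp add: skew_group_algebra_def)

lemma monomial_mult_left_apply:
  assumes "f \<in> carrier CX" "F \<in> carrier A" "x \<in> topspace X"
  shows "(monomial CX f m \<otimes>\<^bsub>A\<^esub> F) n x = f x * F (n - m) (it m x)"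
proof -
  have "(monomial CX f m \<otimes>\<^bsub>A\<^esub> F) n x = (\<Sum>k\<in>{m}. monomial CX f m k x * F (n - k) (it k x))"
    using assms
    by (intro crossed_product_mult_apply[OF sys] monomial_carrier[OF sys]) (auto simp: monomial_def)
  then show ?thesis by (simp add: monomial_def)
qed

lemma monomial_mult_right_apply:
  assumes f: "f \<in> carrier CX" and F: "F \<in> carrier A" and x: "x \<in> topspace X"
  shows "(F \<otimes>\<^bsub>A\<^esub> monomial CX f m) n x = F (n - m) x * f (it (n - m) x)"
proof -
  let ?S = "insert (n - m) {k. F k \<noteq> \<zero>\<^bsub>CX\<^esub>}"
  have fin: "finite ?S" using carrier_support[OF sys F] by simp
  have "(F \<otimes>\<^bsub>A\<^esub> monomial CX f m) n x = (\<Sum>k\<in>?S. F k x * monomial CX f m (n - k) (it k x))"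
    using fin by (intro crossed_product_mult_apply[OF sys] monomial_carrier[OF sys] assms) auto
  also have "\<dots> = (\<Sum>k\<in>{n - m}. F k x * monomial CX f m (n - k) (it k x))"
    using fin x by (intro sum.mono_neutral_right) (auto simp: monomial_def iterate_in[OF sys])
  finally show ?thesis by (simp add: monomial_def)
qed

section \<open>Minimality and invariant ideals of functions\<close>

text \<open>The functions vanishing on an orbit form a proper invariant ideal. If the orbit misses a nonempty open set,
  a bump function supported there is a nonzero member.\<close>

lemma invariant_simple_imp_minimal:
  assumes "invariant_simple CX (induced_action X h)"
  shows "minimal_system X h"
  unfolding minimal_system_def
proof (intro ballI, rule ccontr)
  fix x assume x: "x \<in> topspace X" and nd: "X closure_of orbit X h x \<noteq> topspace X"
  define I where "I = {f \<in> carrier CX. \<forall>n. f (it n x) = 0}"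
  note x_it = iterate_in[OF sys x]
  have "ideal I CX"
  proof (rule CX.idealI_no_inverse)
    fix f g assume f: "f \<in> I"
    show "f \<oplus>\<^bsub>CX\<^esub> g \<in> I" if "g \<in> I"
      using that f CX.add.m_closed[of f g] x_it by (simp add: I_def)
    show "g \<otimes>\<^bsub>CX\<^esub> f \<in> I" "f \<otimes>\<^bsub>CX\<^esub> g \<in> I" if "g \<in> carrier CX"
      using that f CX.m_closed[of f g] CX.m_closed[of g f] x_it by (simp_all add: I_def)
  qed (use CX.zero_closed x_it in \<open>auto simp: I_def\<close>)
  moreover have "induced_action X h n ` I \<subseteq> I" for n
  proof (intro image_subsetI)
    fix f assume f: "f \<in> I"
    have "induced_action X h n f (it m x) = f (it (n + m) x)" for m
      using x_it by (simp add: induced_action_apply iterate_add[OF sys x])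
    then show "induced_action X h n f \<in> I"
      using f induced_action_closed[OF sys] unfolding I_def by auto
  qed
  ultimately have dich: "I = {\<zero>\<^bsub>CX\<^esub>} \<or> I = carrier CX"
    using assms unfolding invariant_simple_def algebra_ideal_CX_iff by blast
  have "\<one>\<^bsub>CX\<^esub> \<notin> I"
    using x_it by (simp add: I_def)
  define C where "C = (X closure_of (orbit X h x))"
  have "C \<subseteq> topspace X" "C \<noteq> topspace X"
    unfolding C_def using nd by (simp_all add: closure_of_subset_topspace)
  then obtain y where y: "y \<in> topspace X - C" by blast
  have "openin X (topspace X - C)"
    unfolding C_def by (intro openin_diff openin_topspace closedin_closure_of)
  then obtain f where f: "f \<in> carrier CX" "f y = 1"
    "\<And>z. z \<in> topspace X \<Longrightarrow> z \<notin> topspace X - C \<Longrightarrow> f z = 0"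
    using bump_function[OF _ y] by metis
  have "orbit X h x \<subseteq> C"
    unfolding C_def using x_it by (intro closure_of_subset) (auto simp: orbit_def)
  moreover have "it n x \<in> orbit X h x" for n
    unfolding orbit_def by blast
  ultimately have "f (it n x) = 0" for n
    using f(3)[OF x_it] by blast
  then have "f \<in> I"
    using f(1) by (simp add: I_def)
  moreover have "f \<noteq> \<zero>\<^bsub>CX\<^esub>"
    using f(2) y by auto
  ultimately show False
    using dich \<open>\<one>\<^bsub>CX\<^esub> \<notin> I\<close> CX.one_closed by blast
qed

text \<open>If \<open>p(x\<^sub>0) \<noteq> 0\<close>, every orbit enters the open set \<open>{p \<noteq> 0}\<close>, so the translates of this set cover \<open>X\<close>.
  A finite subcover turns \<open>p\<close> into a unit inside any invariant ideal that contains \<open>p\<close>.\<close>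

lemma minimal_imp_invariant_simple:
  assumes min: "minimal_system X h"
  shows "invariant_simple CX (induced_action X h)"
  unfolding invariant_simple_def algebra_ideal_CX_iff
proof (intro allI impI, elim conjE)
  fix I assume "ideal I CX" and inv: "\<forall>n. induced_action X h n ` I \<subseteq> I"
  then interpret I: ideal I "cont_algebra X" by simp
  show "I = {\<zero>\<^bsub>CX\<^esub>} \<or> I = carrier CX"
  proof (rule disjCI)
    assume "I \<noteq> carrier CX"
    show "I = {\<zero>\<^bsub>CX\<^esub>}"
    proof (rule ccontr)
      assume "I \<noteq> {\<zero>\<^bsub>CX\<^esub>}"
      then obtain p where p: "p \<in> I" "p \<noteq> \<zero>\<^bsub>CX\<^esub>"
        using I.zero_closed by blast
      have pc: "p \<in> carrier CX" using p I.a_subset by blast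
      obtain x0 where x0: "x0 \<in> topspace X" "p x0 \<noteq> 0" using CX_nonzero[OF pc p(2)] .
      define U where "U n = {x \<in> topspace X. induced_action X h n p x \<noteq> 0}" for n
      have U: "openin X (U n)" for n
      proof -
        have "induced_action X h n p \<in> carrier CX" by (rule induced_action_closed[OF sys pc])
        then have "openin X {x \<in> topspace X. induced_action X h n p x \<in> - {0}}"
          by (intro openin_continuous_map_preimage[of X euclidean]) auto
        then show ?thesis by (simp add: U_def)
      qed
      have "topspace X \<subseteq> \<Union>(range U)"
      proof
        fix y assume y: "y \<in> topspace X"
        have "x0 \<in> X closure_of orbit X h y"
          using min y x0 by (simp add: minimal_system_def)
        moreover have "x0 \<in> U 0"
          using x0 by (simp add: U_def induced_action_apply iterate_0[OF sys])
        ultimately obtain n where "it n y \<in> U 0"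
          using U[of 0] unfolding in_closure_of orbit_def by blast
        then have "y \<in> U n"
          using y by (auto simp: U_def induced_action_apply iterate_0[OF sys])
        then show "y \<in> \<Union>(range U)" by blast
      qed
      moreover have "compactin X (topspace X)"
        using sys by (simp add: topological_dynamical_system_def compact_space_def)
      ultimately obtain \<F> where "finite \<F>" "\<F> \<subseteq> range U" "topspace X \<subseteq> \<Union>\<F>"
        using compactinD[of X "topspace X" "range U"] U by blast
      then obtain N where N: "finite N" "topspace X \<subseteq> (\<Union>n\<in>N. U n)"
        by (metis finite_subset_image)
      \<comment> \<open>the factor \<open>cnj\<close> makes the summands nonnegative, so that they cannot cancel\<close>
      define q where
        "q n = (\<lambda>x \<in> topspace X. cnj (induced_action X h n p x)) \<otimes>\<^bsub>CX\<^esub> induced_action X h n p" for n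
      have qI: "q n \<in> I" for n
        unfolding q_def
        by (rule I.I_l_closed) (use inv p CX_cnj induced_action_closed[OF sys pc] in blast)+
      define s where "s = finsum CX q N"
      have sI: "s \<in> I" unfolding s_def by (rule I.finsum_in_ideal[OF qI])
      have "q n \<in> carrier CX" for n using qI I.a_subset by blast
      then have s: "s = (\<lambda>x \<in> topspace X. \<Sum>n\<in>N. q n x)"
        unfolding s_def by (intro finsum_cont_algebra N) auto
      have qx: "q n x = complex_of_real ((cmod (induced_action X h n p x))\<^sup>2)" if "x \<in> topspace X" for n x
        using that complex_norm_square[of "induced_action X h n p x"] by (simp add: q_def mult.commute)
      have "s x \<noteq> 0" if x: "x \<in> topspace X" for x
      proof -
        obtain m where m: "m \<in> N" "induced_action X h m p x \<noteq> 0"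
          using N x by (auto simp: U_def)
        have "0 < (\<Sum>n\<in>N. (cmod (induced_action X h n p x))\<^sup>2)"
          by (rule sum_pos2[OF N(1) m(1)]) (use m in auto)
        moreover have "s x = complex_of_real (\<Sum>n\<in>N. (cmod (induced_action X h n p x))\<^sup>2)"
          using x by (simp add: s qx)
        ultimately show ?thesis by (metis less_irrefl of_real_eq_0_iff)
      qed
      then obtain g where g: "g \<in> carrier CX" "g \<otimes>\<^bsub>CX\<^esub> s = \<one>\<^bsub>CX\<^esub>"
        using CX_unit[of s] sI I.a_subset by blast
      then have "\<one>\<^bsub>CX\<^esub> \<in> I" using I.I_l_closed[OF sI g(1)] by simp
      then show False using I.one_imp_carrier \<open>I \<noteq> carrier CX\<close> by blast
    qed
  qed
qed

section \<open>Freeness\<close>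

lemma iterate_mult_period:
  assumes x: "x \<in> topspace X" and per: "it n x = x"
  shows "it (q * n) x = x"
proof (induction q rule: int_induct[where k = 0])
  case base
  show ?case by (simp add: iterate_0[OF sys])
next
  case (step1 i)
  then show ?case using iterate_add[OF sys x, of "i * n" n] per by (simp add: algebra_simps)
next
  case (step2 i)
  then show ?case using iterate_add[OF sys x, of "(i - 1) * n" n] per by (simp add: algebra_simps)
qed

text \<open>The orbit of a periodic point is finite, hence closed, so its density would make the whole
  space finite.\<close>

lemma minimal_imp_free:
  assumes min: "minimal_system X h" and inf: "infinite (topspace X)"
  shows "free_action X h"
  unfolding free_action_def
proof (intro ballI allI impI notI)
  fix x n assume x: "x \<in> topspace X" and n: "(n::int) \<noteq> 0" and per: "it n x = x"
  \<comment> \<open>for negative \<open>n\<close> the remainder \<open>m mod n\<close> is nonpositive, hence the symmetric range\<close>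
  have "it m x \<in> (\<lambda>r. it r x) ` {-\<bar>n\<bar>..\<bar>n\<bar>}" for m
  proof
    have "it (m mod n + m div n * n) x = it (m mod n) (it (m div n * n) x)"
      by (rule iterate_add[OF sys x])
    then show "it m x = it (m mod n) x"
      by (simp add: iterate_mult_period[OF x per])
    have "\<bar>m mod n\<bar> < \<bar>n\<bar>" using n by (rule abs_mod_less)
    then show "m mod n \<in> {-\<bar>n\<bar>..\<bar>n\<bar>}" by auto
  qed
  then have "orbit X h x \<subseteq> (\<lambda>r. it r x) ` {-\<bar>n\<bar>..\<bar>n\<bar>}"
    by (auto simp: orbit_def)
  then have fin: "finite (orbit X h x)"
    using finite_subset by blast
  have "closedin X (orbit X h x)"
    using sys fin iterate_in[OF sys x]
    by (intro closedin_Hausdorff_finite) (auto simp: orbit_def topological_dynamical_system_def)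
  then have "orbit X h x = topspace X"
    using min x by (simp add: minimal_system_def closure_of_eq[symmetric])
  then show False using fin inf by simp
qed

text \<open>The degree \<open>n\<close> coefficients of \<open>F f\<close> and \<open>f F\<close> are \<open>F\<^sub>n (f \<circ> h\<^sup>n)\<close> and \<open>f F\<^sub>n\<close>. A function \<open>f\<close> with
  \<open>f(x) = 1\<close> and \<open>f(h\<^sup>n x) = 0\<close> therefore forces \<open>F\<^sub>n(x) = 0\<close> when \<open>F\<close> commutes with \<open>f\<close>.\<close>

lemma free_imp_maximal_commutative:
  assumes free: "free_action X h"
  shows "maximal_commutative (coefficient_copy CX) A"
proof -
  have sub: "coefficient_copy CX \<subseteq> carrier A"
    unfolding coefficient_copy_def using monomial_carrier[OF sys] by blast
  have comm: "F \<otimes>\<^bsub>A\<^esub> G = G \<otimes>\<^bsub>A\<^esub> F" if FG: "F \<in> coefficient_copy CX" "G \<in> coefficient_copy CX" for F G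
  proof -
    obtain f g where fg: "F = monomial CX f 0" "G = monomial CX g 0" "f \<in> carrier CX" "g \<in> carrier CX"
      using FG unfolding coefficient_copy_def by blast
    show ?thesis
    proof (rule ext_carrier[OF sys])
      fix n x assume x: "x \<in> topspace X"
      show "(F \<otimes>\<^bsub>A\<^esub> G) n x = (G \<otimes>\<^bsub>A\<^esub> F) n x"
        using x fg sub FG monomial_mult_left_apply[of f G x 0 n] monomial_mult_right_apply[of f G x 0 n]
        by (auto simp: iterate_0[OF sys] monomial_def)
    qed (use sub FG in \<open>auto intro!: crossed_product_mult_closed[OF sys]\<close>)
  qed
  have "commutant A (coefficient_copy CX) \<subseteq> coefficient_copy CX"
  proof
    fix F assume "F \<in> commutant A (coefficient_copy CX)"
    then have F: "F \<in> carrier A"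
      and cF: "\<And>f. f \<in> carrier CX \<Longrightarrow> F \<otimes>\<^bsub>A\<^esub> monomial CX f 0 = monomial CX f 0 \<otimes>\<^bsub>A\<^esub> F"
      unfolding commutant_def coefficient_copy_def by auto
    have zero: "F n x = 0" if n: "n \<noteq> 0" and x: "x \<in> topspace X" for n x
    proof -
      have "it n x \<noteq> x" using free n x by (simp add: free_action_def)
      then have "openin X (topspace X - {it n x})" "x \<in> topspace X - {it n x}"
        using sys x open_in_Hausdorff_delete[of X "topspace X"]
        by (auto simp: topological_dynamical_system_def)
      then obtain f where f: "f \<in> carrier CX" "f x = 1" "f (it n x) = 0"
        using bump_function iterate_in[OF sys x] by (metis DiffD2 insertCI)
      have "F n x * f (it n x) = f x * F n x"
        using fun_cong[OF fun_cong[OF cF[OF f(1)], of n], of x]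
        by (simp add: monomial_mult_left_apply[OF f(1) F x] monomial_mult_right_apply[OF f(1) F x]
            iterate_0[OF sys])
      then show ?thesis using f by simp
    qed
    have "F = monomial CX (F 0) 0"
      using zero by (intro ext_carrier[OF sys] F monomial_carrier[OF sys] coefficient_closed)
        (auto simp: monomial_def)
    then show "F \<in> coefficient_copy CX"
      unfolding coefficient_copy_def using coefficient_closed[OF F] by blast
  qed
  then have eq: "coefficient_copy CX = commutant A (coefficient_copy CX)"
    using sub comm unfolding commutant_def by blast
  have "subring (coefficient_copy CX) A"
    using A.subring_commutant[OF sub] eq unfolding commutant_def by simp
  then have "subcring (coefficient_copy CX) A"
    by (rule A.subcringI) (rule comm)
  moreover have "c \<odot>\<^bsub>A\<^esub> F \<in> coefficient_copy CX" if F: "F \<in> coefficient_copy CX" for c F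
  proof -
    obtain f where f: "f \<in> carrier CX" "F = monomial CX f 0"
      using F unfolding coefficient_copy_def by blast
    have "c \<odot>\<^bsub>A\<^esub> F = monomial CX (c \<odot>\<^bsub>CX\<^esub> f) 0"
      by (auto simp: f skew_group_algebra_def monomial_def fun_eq_iff)
    moreover have "c \<odot>\<^bsub>CX\<^esub> f \<in> carrier CX"
      using f by (auto simp: continuous_map_restrict_topspace intro!: continuous_map_complex_mult)
    ultimately show ?thesis unfolding coefficient_copy_def by blast
  qed
  ultimately show ?thesis
    using eq unfolding maximal_commutative_def commutative_subalgebra_def by blast
qed

section \<open>Ideals of the crossed product\<close>

text \<open>Each \<open>k\<close> contributes \<open>V \<inter> h\<^sup>-\<^sup>k W\<close>, where \<open>V\<close> and \<open>W\<close> are disjoint neighbourhoods of \<open>x\<close> and \<open>h\<^sup>k x\<close>;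
  finitely many of these are intersected.\<close>

lemma disjoint_translates_neighbourhood:
  assumes "finite K" "x \<in> topspace X" "\<And>k. k \<in> K \<Longrightarrow> it k x \<noteq> x"
  obtains U where "openin X U" "x \<in> U" "\<And>k y. k \<in> K \<Longrightarrow> y \<in> U \<Longrightarrow> it k y \<notin> U"
proof -
  have "\<exists>U. openin X U \<and> x \<in> U \<and> (\<forall>k\<in>K. \<forall>y\<in>U. it k y \<notin> U)"
    using assms
  proof (induction K)
    case empty
    then show ?case by blast
  next
    case (insert k K)
    then obtain U where U: "openin X U" "x \<in> U" "\<forall>k\<in>K. \<forall>y\<in>U. it k y \<notin> U" by auto
    have "Hausdorff_space X" using sys by (simp add: topological_dynamical_system_def)
    then obtain V W where VW: "openin X V" "openin X W" "x \<in> V" "it k x \<in> W" "disjnt V W"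
      using insert.prems iterate_in[OF sys, of x k] unfolding Hausdorff_space_def by (metis insertI1)
    let ?W = "{y \<in> topspace X. it k y \<in> W}"
    have "openin X ?W"
      by (rule openin_continuous_map_preimage[OF continuous_map_iterate[OF sys] VW(2)])
    then have "openin X (U \<inter> V \<inter> ?W)" using U VW by blast
    moreover have "x \<in> U \<inter> V \<inter> ?W" using U VW insert.prems by blast
    moreover have "\<forall>j\<in>insert k K. \<forall>y\<in>U \<inter> V \<inter> ?W. it j y \<notin> U \<inter> V \<inter> ?W"
      using U VW by (auto simp: disjnt_iff)
    ultimately show ?case by blast
  qed
  then show ?thesis using that by blast
qed

text \<open>Multiplying by a power of the generator on the right moves a nonzero coefficient to degree \<open>0\<close>.
  In \<open>f G f\<close> the coefficient of degree \<open>n\<close> is \<open>f G\<^sub>n (f \<circ> h\<^sup>n)\<close>, which vanishes for \<open>n \<noteq> 0\<close> once \<open>f\<close> is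
  supported in a set disjoint from its relevant translates. What remains is \<open>f\<^sup>2 G\<^sub>0\<close> in degree \<open>0\<close>.\<close>

lemma free_imp_ideal_meets_coefficients:
  assumes free: "free_action X h" and I: "ideal I A" and nz: "I \<noteq> {\<zero>\<^bsub>A\<^esub>}"
  obtains p where "p \<in> carrier CX" "p \<noteq> \<zero>\<^bsub>CX\<^esub>" "monomial CX p 0 \<in> I"
proof -
  interpret I: ideal I "crossed_product X h" by (rule I)
  obtain F where FI: "F \<in> I" and F0: "F \<noteq> \<zero>\<^bsub>A\<^esub>" using nz I.zero_closed by blast
  have F: "F \<in> carrier A" using FI I.a_subset by blast
  have "\<exists>m. F m \<noteq> \<zero>\<^bsub>CX\<^esub>"
    using F0 by (auto simp: skew_group_algebra_def fun_eq_iff simp del: cont_algebra_simps)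
  then obtain m where m: "F m \<noteq> \<zero>\<^bsub>CX\<^esub>" by blast
  obtain x where x: "x \<in> topspace X" "F m x \<noteq> 0"
    using CX_nonzero[OF coefficient_closed[OF F] m] .
  \<comment> \<open>the nonzero degrees that survive after the degree \<open>m\<close> has been shifted to \<open>0\<close>\<close>
  define K where "K = (\<lambda>k. k - m) ` {k. F k \<noteq> \<zero>\<^bsub>CX\<^esub>} - {0}"
  have "finite K" unfolding K_def using carrier_support[OF sys F] by simp
  moreover have "it k x \<noteq> x" if "k \<in> K" for k
    using free that x by (simp add: free_action_def K_def)
  ultimately obtain U where U: "openin X U" "x \<in> U" "\<And>k y. k \<in> K \<Longrightarrow> y \<in> U \<Longrightarrow> it k y \<notin> U"
    using disjoint_translates_neighbourhood x(1) by blast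
  obtain f where f: "f \<in> carrier CX" "f x = 1" "\<And>y. y \<in> topspace X \<Longrightarrow> y \<notin> U \<Longrightarrow> f y = 0"
    using bump_function[OF U(1,2)] by blast
  define p where "p = f \<otimes>\<^bsub>CX\<^esub> (F m \<otimes>\<^bsub>CX\<^esub> f)"
  have p: "p \<in> carrier CX"
    unfolding p_def by (intro CX.m_closed f coefficient_closed F)
  define G where "G = F \<otimes>\<^bsub>A\<^esub> monomial CX \<one>\<^bsub>CX\<^esub> (- m)"
  have one: "monomial CX \<one>\<^bsub>CX\<^esub> (- m) \<in> carrier A" by (rule monomial_carrier[OF sys CX.one_closed])
  have f0: "monomial CX f 0 \<in> carrier A" by (rule monomial_carrier[OF sys f(1)])
  have GI: "G \<in> I" unfolding G_def by (rule I.I_r_closed[OF FI one])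
  then have G: "G \<in> carrier A" using I.a_subset by blast
  have G_apply: "G n y = F (n + m) y" if y: "y \<in> topspace X" for n y
    unfolding G_def using monomial_mult_right_apply[OF CX.one_closed F y, of "- m" n] iterate_in[OF sys y]
    by simp
  define H where "H = monomial CX f 0 \<otimes>\<^bsub>A\<^esub> (G \<otimes>\<^bsub>A\<^esub> monomial CX f 0)"
  have HI: "H \<in> I" unfolding H_def by (intro I.I_l_closed I.I_r_closed GI f0)
  then have Hc: "H \<in> carrier A" using I.a_subset by blast
  have H_apply: "H n y = f y * (F (n + m) y * f (it n y))" if y: "y \<in> topspace X" for n y
    unfolding H_def
    using monomial_mult_left_apply[OF f(1) A.m_closed[OF G f0] y, of 0 n]
      monomial_mult_right_apply[OF f(1) G y, of 0 n] G_apply[OF y] by (simp add: iterate_0[OF sys])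
  have "H = monomial CX p 0"
  proof (rule ext_carrier[OF sys Hc monomial_carrier[OF sys p]])
    fix n y assume y: "y \<in> topspace X"
    show "H n y = monomial CX p 0 n y"
    proof (cases "n = 0")
      case True
      then show ?thesis using y H_apply[OF y] by (simp add: monomial_def p_def iterate_0[OF sys])
    next
      case False
      have "f y * (F (n + m) y * f (it n y)) = 0"
      proof (cases "n \<in> K")
        case True
        then show ?thesis using U(3)[of n y] f(3) y iterate_in[OF sys y] by fastforce
      next
        case nK: False
        have "F (n + m) = \<zero>\<^bsub>CX\<^esub>"
          using nK False unfolding K_def
          by (metis (mono_tags, lifting) Diff_iff add_diff_cancel_right' imageI mem_Collect_eq singletonD)
        then show ?thesis using y by simp
      qed
      then show ?thesis using False y H_apply[OF y] by (simp add: monomial_def)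
    qed
  qed
  moreover have "p x = F m x" using x f by (simp add: p_def)
  then have "p \<noteq> \<zero>\<^bsub>CX\<^esub>" using x by auto
  ultimately show ?thesis using that p HI by blast
qed

text \<open>The trace of an ideal on \<open>C(X)\<close> is invariant because \<open>\<sigma>\<^sub>n\<close> is conjugation by \<open>u\<^sub>n\<close>; by freeness it is
  nonzero, so \<open>\<int>\<close>-simplicity puts \<open>\<one>\<close> into it.\<close>

lemma invariant_simple_free_imp_simple:
  assumes free: "free_action X h" and simp: "invariant_simple CX (induced_action X h)"
  shows "simple_algebra A"
  unfolding simple_algebra_def
proof (intro allI impI disjCI)
  fix I assume "algebra_ideal I A" and nc: "I \<noteq> carrier A"
  then interpret I: ideal I "crossed_product X h" by (simp add: algebra_ideal_def)
  show "I = {\<zero>\<^bsub>A\<^esub>}"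
  proof (rule ccontr)
    assume "I \<noteq> {\<zero>\<^bsub>A\<^esub>}"
    then obtain p where p: "p \<in> carrier CX" "p \<noteq> \<zero>\<^bsub>CX\<^esub>" "monomial CX p 0 \<in> I"
      using free_imp_ideal_meets_coefficients[OF free I.is_ideal] by blast
    define J where "J = {f \<in> carrier CX. monomial CX f 0 \<in> I}"
    have mono0: "monomial CX f 0 \<otimes>\<^bsub>A\<^esub> monomial CX g 0 = monomial CX (f \<otimes>\<^bsub>CX\<^esub> g) 0"
      if "f \<in> carrier CX" "g \<in> carrier CX" for f g
    proof -
      have "induced_action X h 0 g = g"
        using that
        by (intro CX_eqI induced_action_closed[OF sys]) (auto simp: induced_action_apply iterate_0[OF sys])
      then show ?thesis using monomial_mult[OF sys that, of 0 0] by simp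
    qed
    have "ideal J CX"
    proof (rule CX.idealI_no_inverse)
      have "monomial CX \<zero>\<^bsub>CX\<^esub> 0 = \<zero>\<^bsub>A\<^esub>"
        by (auto simp: monomial_def skew_group_algebra_def)
      then show "\<zero>\<^bsub>CX\<^esub> \<in> J"
        using CX.zero_closed I.zero_closed unfolding J_def by auto
      fix f g assume f: "f \<in> J"
      show "f \<oplus>\<^bsub>CX\<^esub> g \<in> J" if g: "g \<in> J"
      proof -
        have "monomial CX (f \<oplus>\<^bsub>CX\<^esub> g) 0 = monomial CX f 0 \<oplus>\<^bsub>A\<^esub> monomial CX g 0"
          by (auto simp: monomial_def skew_group_algebra_def fun_eq_iff)
        then show ?thesis
          using f g I.a_closed CX.add.m_closed unfolding J_def by auto
      qed
      assume g: "g \<in> carrier CX"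
      then have g0: "monomial CX g 0 \<in> carrier A" by (rule monomial_carrier[OF sys])
      show "g \<otimes>\<^bsub>CX\<^esub> f \<in> J"
        using f g I.I_l_closed[OF _ g0, of "monomial CX f 0"] mono0[of g f] CX.m_closed[of g f]
        unfolding J_def by auto
      show "f \<otimes>\<^bsub>CX\<^esub> g \<in> J"
        using f g I.I_r_closed[OF _ g0, of "monomial CX f 0"] mono0[of f g] CX.m_closed[of f g]
        unfolding J_def by auto
    qed (auto simp: J_def)
    moreover have "induced_action X h n ` J \<subseteq> J" for n
    proof (intro image_subsetI)
      fix f assume f: "f \<in> J"
      then have fc: "f \<in> carrier CX" by (simp add: J_def)
      let ?u = "\<lambda>n. monomial CX \<one>\<^bsub>CX\<^esub> n"
      have u: "?u k \<in> carrier A" for k by (rule monomial_carrier[OF sys CX.one_closed])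
      have "?u n \<otimes>\<^bsub>A\<^esub> (monomial CX f 0 \<otimes>\<^bsub>A\<^esub> ?u (- n)) \<in> I"
        using f by (intro I.I_l_closed I.I_r_closed u) (simp add: J_def)
      moreover have "?u n \<otimes>\<^bsub>A\<^esub> (monomial CX f 0 \<otimes>\<^bsub>A\<^esub> ?u (- n)) = monomial CX (induced_action X h n f) 0"
      proof (rule ext_carrier[OF sys])
        have f0: "monomial CX f 0 \<in> carrier A" by (rule monomial_carrier[OF sys fc])
        show "?u n \<otimes>\<^bsub>A\<^esub> (monomial CX f 0 \<otimes>\<^bsub>A\<^esub> ?u (- n)) \<in> carrier A"
          by (intro A.m_closed u f0)
        show "monomial CX (induced_action X h n f) 0 \<in> carrier A"
          by (intro monomial_carrier[OF sys] induced_action_closed[OF sys] fc)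
        fix k x assume x: "x \<in> topspace X"
        note xn = iterate_in[OF sys x, of n]
        show "(?u n \<otimes>\<^bsub>A\<^esub> (monomial CX f 0 \<otimes>\<^bsub>A\<^esub> ?u (- n))) k x = monomial CX (induced_action X h n f) 0 k x"
          unfolding monomial_mult_left_apply[OF CX.one_closed A.m_closed[OF f0 u] x]
            monomial_mult_left_apply[OF fc u xn]
          using x xn by (auto simp: monomial_def iterate_0[OF sys] induced_action_apply)
      qed
      ultimately show "induced_action X h n f \<in> J"
        using induced_action_closed[OF sys fc] unfolding J_def by simp
    qed
    ultimately have "J = {\<zero>\<^bsub>CX\<^esub>} \<or> J = carrier CX"
      using simp unfolding invariant_simple_def algebra_ideal_CX_iff by blast
    moreover have "p \<in> J" using p by (simp add: J_def)
    ultimately have "\<one>\<^bsub>CX\<^esub> \<in> J" using p CX.one_closed by blast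
    then have "\<one>\<^bsub>A\<^esub> \<in> I" unfolding one_monomial[OF sys] J_def by blast
    then show False using nc I.one_imp_carrier by blast
  qed
qed

text \<open>The sums with all coefficients in \<open>J\<close> form an ideal; invariance of \<open>J\<close> is what keeps it stable under
  multiplication from the left.\<close>

lemma simple_imp_invariant_simple:
  assumes simp: "simple_algebra A"
  shows "invariant_simple CX (induced_action X h)"
  unfolding invariant_simple_def
proof (intro allI impI, elim conjE)
  fix J assume aJ: "algebra_ideal J CX" and inv: "\<forall>n. induced_action X h n ` J \<subseteq> J"
  interpret J: ideal J "cont_algebra X" using aJ by (simp add: algebra_ideal_def)
  define I where "I = {F \<in> carrier A. \<forall>n. F n \<in> J}"
  have "ideal I A"
  proof (rule A.idealI_no_inverse)
    show "\<zero>\<^bsub>A\<^esub> \<in> I"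
      using A.zero_closed J.zero_closed unfolding I_def by (auto simp: skew_group_algebra_def)
    fix F G assume "F \<in> I"
    then have F: "F \<in> carrier A" "\<And>n. F n \<in> J" unfolding I_def by auto
    show "F \<oplus>\<^bsub>A\<^esub> G \<in> I" if "G \<in> I"
    proof -
      have "(F \<oplus>\<^bsub>A\<^esub> G) n = F n \<oplus>\<^bsub>CX\<^esub> G n" for n by (simp add: skew_group_algebra_def)
      then show ?thesis
        using F that A.add.m_closed[of F G] J.a_closed unfolding I_def by auto
    qed
    assume G: "G \<in> carrier A"
    have mult: "(P \<otimes>\<^bsub>A\<^esub> Q) n
        = finsum CX (\<lambda>k. P k \<otimes>\<^bsub>CX\<^esub> induced_action X h k (Q (n - k))) {k. P k \<noteq> \<zero>\<^bsub>CX\<^esub>}" for P Q n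
      by (simp add: skew_group_algebra_def)
    have "(G \<otimes>\<^bsub>A\<^esub> F) n \<in> J" for n
      unfolding mult
      by (intro J.finsum_in_ideal J.I_l_closed coefficient_closed G) (use inv F in blast)
    then show "G \<otimes>\<^bsub>A\<^esub> F \<in> I" using A.m_closed[OF G F(1)] by (simp add: I_def)
    have "(F \<otimes>\<^bsub>A\<^esub> G) n \<in> J" for n
      unfolding mult
      by (intro J.finsum_in_ideal J.I_r_closed F induced_action_closed[OF sys] coefficient_closed G)
    then show "F \<otimes>\<^bsub>A\<^esub> G \<in> I" using A.m_closed[OF F(1) G] by (simp add: I_def)
  qed (auto simp: I_def)
  moreover have "c \<odot>\<^bsub>A\<^esub> F \<in> I" if "F \<in> I" for c F
  proof -
    have F: "F \<in> carrier A" "\<And>n. F n \<in> J" using that unfolding I_def by auto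
    have app: "(c \<odot>\<^bsub>A\<^esub> F) n = c \<odot>\<^bsub>CX\<^esub> F n" for n by (simp add: skew_group_algebra_def)
    then have cJ: "(c \<odot>\<^bsub>A\<^esub> F) n \<in> J" for n
      using aJ F by (auto simp: algebra_ideal_def)
    have "{n. (c \<odot>\<^bsub>A\<^esub> F) n \<noteq> \<zero>\<^bsub>CX\<^esub>} \<subseteq> {n. F n \<noteq> \<zero>\<^bsub>CX\<^esub>}"
      by (auto simp: app)
    then have "finite {n. (c \<odot>\<^bsub>A\<^esub> F) n \<noteq> \<zero>\<^bsub>CX\<^esub>}"
      using carrier_support[OF sys F(1)] finite_subset by blast
    moreover have "(c \<odot>\<^bsub>A\<^esub> F) n \<in> carrier CX" for n
      using cJ J.a_subset by blast
    ultimately have "c \<odot>\<^bsub>A\<^esub> F \<in> carrier A"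
      by (subst skew_group_algebra_def) (simp del: cont_algebra_simps)
    then show ?thesis using cJ unfolding I_def by blast
  qed
  ultimately have "I = {\<zero>\<^bsub>A\<^esub>} \<or> I = carrier A"
    using simp unfolding simple_algebra_def algebra_ideal_def by blast
  then show "J = {\<zero>\<^bsub>CX\<^esub>} \<or> J = carrier CX"
  proof
    assume I0: "I = {\<zero>\<^bsub>A\<^esub>}"
    have "f = \<zero>\<^bsub>CX\<^esub>" if f: "f \<in> J" for f
    proof -
      have "monomial CX f 0 \<in> carrier A" using f J.a_subset by (intro monomial_carrier[OF sys]) blast
      moreover have "monomial CX f 0 n \<in> J" for n
        using f J.zero_closed by (simp add: monomial_def del: cont_algebra_simps)
      ultimately have "monomial CX f 0 = \<zero>\<^bsub>A\<^esub>" using I0 unfolding I_def by blast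
      then have "monomial CX f 0 0 = \<zero>\<^bsub>A\<^esub> 0" by simp
      then show ?thesis by (simp add: monomial_def skew_group_algebra_def)
    qed
    then show ?thesis using J.zero_closed by blast
  next
    assume "I = carrier A"
    then have "\<one>\<^bsub>A\<^esub> 0 \<in> J" using A.one_closed unfolding I_def by blast
    then have "\<one>\<^bsub>CX\<^esub> \<in> J" by (simp add: skew_group_algebra_def)
    then show ?thesis using J.one_imp_carrier by blast
  qed
qed

end

section \<open>Simplicity of the crossed product\<close>

theorem theorem8p6:
  fixes X :: "'a topology" and h :: "'a \<Rightarrow> 'a"
  assumes "topological_dynamical_system X h"
    and "infinite (topspace X)"
  shows "(simple_algebra (crossed_product X h) \<longleftrightarrow>
            maximal_commutative (coefficient_copy (cont_algebra X)) (crossed_product X h) \<and>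
            invariant_simple (cont_algebra X) (induced_action X h))
       \<and> (simple_algebra (crossed_product X h) \<longleftrightarrow> minimal_system X h)"
proof -
  note sys = assms(1)
  have "simple_algebra (crossed_product X h)" "invariant_simple (cont_algebra X) (induced_action X h)"
    "maximal_commutative (coefficient_copy (cont_algebra X)) (crossed_product X h)"
    if min: "minimal_system X h"
  proof -
    have free: "free_action X h" by (rule minimal_imp_free[OF sys min assms(2)])
    show inv: "invariant_simple (cont_algebra X) (induced_action X h)"
      by (rule minimal_imp_invariant_simple[OF sys min])
    show "simple_algebra (crossed_product X h)"
      by (rule invariant_simple_free_imp_simple[OF sys free inv])
    show "maximal_commutative (coefficient_copy (cont_algebra X)) (crossed_product X h)"
      by (rule free_imp_maximal_commutative[OF sys free])
  qed
  moreover have "minimal_system X h" if "invariant_simple (cont_algebra X) (induced_action X h)"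
    by (rule invariant_simple_imp_minimal[OF sys that])
  moreover have "invariant_simple (cont_algebra X) (induced_action X h)"
    if "simple_algebra (crossed_product X h)"
    by (rule simple_imp_invariant_simple[OF sys that])
  ultimately show ?thesis by blast
qed

end
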